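(* Let $(\mathfrak g,Q)$ be a finite dimensional $L_\infty$-algebra. Then $(\mathfrak g,Q)$ can be extended to a unimodular $L_\infty$-algebra $(\mathfrak g,Q,f)$ if and only if its characteristic class $[\mathrm{div}\,Q]\in H^1(\mathcal O_{\mathfrak g[1]},Q)$ vanishes.
   Context: $\mathbb k$ is a field of characteristic zero; $\mathfrak g$ is a finite dimensional graded vector space; $\mathfrak g[1]^i=\mathfrak g^{i+1}$. $\mathcal O_{\mathfrak g[1]}=\prod_{n\ge0}\odot^n\mathfrak g[1]^*$ (functions on the formal pointed graded manifold $(\mathfrak g[1],0)$; the ideal of $0$ is $\prod_{n\ge1}$), $\mathcal T_{\mathfrak g[1]}=\mathrm{Der}\,\mathcal O_{\mathfrak g[1]}$ (vector fields). A basis of $\mathfrak g$ gives linear coordinates $x^\alpha$ on $\mathfrak g[1]$ with $\mathcal O_{\mathfrak g[1]}\cong\mathbb k[[x^\alpha]]$ and $\mathcal T_{\mathfrak g[1]}$ free on $\partial_\alpha=\partial/\partial x^\alpha$. For $V=V^\alpha\partial_\alpha$ the divergence with respect to the constant volume form is $\mathrm{div}\,V=\sum_\alpha(-1)^{|x^\alpha||V^\alpha|}\partial_\alpha V^\alpha$. An $L_\infty$-structure on $\mathfrak g$ (its differential included) is a vector field $Q$ of degree $1$ with $Q^2=0$ and $Q|_0=0$; then $Q$ is a differential on $\mathcal O_{\mathfrak g[1]}$. A unimodular $L_\infty$-algebra $(\mathfrak g,Q,f)$ is such a $Q$ together with a degree zero function $f$ in the ideal of $0$ such that $\mathrm{div}\,Q+Q(f)=0$.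 For an $L_\infty$-algebra $(\mathfrak g,Q)$ one has $Q(\mathrm{div}\,Q)=0$, and the class $[\mathrm{div}\,Q]\in H^1(\mathcal O_{\mathfrak g[1]},Q)$ is called its characteristic class. *)

theory Defs
  imports Complex_Main "HOL-Library.Poly_Mapping" "HOL-Library.Function_Algebras"
begin

section \<open>Finite dimensional graded vector spaces\<close>

locale graded_vector_space = vector_space scale
  for scale :: "'k::field_char_0 \<Rightarrow> 'v::ab_group_add \<Rightarrow> 'v" +
  fixes V :: "int \<Rightarrow> 'v set"
  assumes subspace_component: "subspace (V i)"
    and direct_sum:
      "\<exists>!c. (\<forall>i. c i \<in> V i) \<and> finite {i. c i \<noteq> 0} \<and> v = (\<Sum>i | c i \<noteq> 0. c i)"
begin

definition homogeneous_basis :: "'v list \<Rightarrow> bool" where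
  "homogeneous_basis es \<longleftrightarrow>
     distinct es \<and> independent (set es) \<and> span (set es) = UNIV \<and>
     (\<forall>e\<in>set es. \<exists>i. e \<in> V i)"

text \<open>Fixing an ordered homogeneous basis is no restriction on a finite dimensional graded space.\<close>

lemma homogeneous_basis_exists:
  assumes "finite B" "span B = UNIV"
  shows "\<exists>es. homogeneous_basis es"
proof -
  obtain C where C: "C \<subseteq> (\<Union>i. V i)" "independent C" "(\<Union>i. V i) \<subseteq> span C"
    using maximal_independent_subset by blast
  have "v \<in> span C" for v
  proof -
    obtain c where c: "\<forall>i. c i \<in> V i" "v = (\<Sum>i | c i \<noteq> 0. c i)"
      using direct_sum[of v] by blast
    show ?thesis unfolding c(2) using c(1) C(3) by (intro span_sum) blast
  qed
  then have span: "span C = UNIV" by blast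
  have "finite C"
    using independent_span_bound[OF assms(1) C(2)] assms(2) by blast
  then obtain es where "set es = C" "distinct es"
    using finite_distinct_list by blast
  then have "homogeneous_basis es"
    using C(1,2) span unfolding homogeneous_basis_def by blast
  then show ?thesis ..
qed

end

definition shift :: "(int \<Rightarrow> 'v set) \<Rightarrow> int \<Rightarrow> 'v set" where
  "shift V i = V (i + 1)"

text \<open>The coordinates on \<open>\<gg>[1]\<close> form the basis of \<open>\<gg>[1]\<^sup>*\<close> dual to \<open>es\<close>, and dualising negates
  degrees. Nonzero homogeneous vectors have a unique degree, so the description is proper on
  homogeneous bases.\<close>

definition coordinate_degrees :: "(int \<Rightarrow> 'v set) \<Rightarrow> 'v list \<Rightarrow> int list" where
  "coordinate_degrees V es = map (\<lambda>e. - (THE i. e \<in> shift V i)) es"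

section \<open>Formal functions in graded commuting coordinates\<close>

text \<open>Throughout, \<open>ds ! i\<close> is the degree of the coordinate \<open>x\<^sub>i\<close>, for \<open>i < length ds\<close>.
  A series is its family of coefficients with respect to the ordered monomials
  \<open>x\<^sup>m = x\<^sub>0\<^sup>m\<^sup>0 x\<^sub>1\<^sup>m\<^sup>1 \<dots>\<close>, in which an odd coordinate occurs at most once.\<close>

type_synonym monomial = "nat \<Rightarrow>\<^sub>0 nat"
type_synonym 'k series = "monomial \<Rightarrow> 'k"

definition monomials :: "int list \<Rightarrow> monomial set" where
  "monomials ds = {m. Poly_Mapping.keys m \<subseteq> {..<length ds} \<and>
     (\<forall>i<length ds. odd (ds ! i) \<longrightarrow> Poly_Mapping.lookup m i \<le> 1)}"

definition coordinate_degree_in :: "int list \<Rightarrow> monomial \<Rightarrow> nat \<Rightarrow> int" where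
  "coordinate_degree_in ds m i = int (Poly_Mapping.lookup m i) * ds ! i"

definition monomial_degree :: "int list \<Rightarrow> monomial \<Rightarrow> int" where
  "monomial_degree ds m = (\<Sum>i<length ds. coordinate_degree_in ds m i)"

text \<open>The graded algebra of functions is represented by its homogeneous components. Being
  graded, it consists in degree \<open>d\<close> of all series of monomials of degree \<open>d\<close>; conditions on
  graded maps below are accordingly imposed on homogeneous functions only.\<close>

definition graded_functions :: "int list \<Rightarrow> int \<Rightarrow> 'k::field_char_0 series set" where
  "graded_functions ds d = {a. \<forall>m. a m \<noteq> 0 \<longrightarrow> m \<in> monomials ds \<and> monomial_degree ds m = d}"

definition eval_at_origin :: "'k::field_char_0 series \<Rightarrow> 'k" where
  "eval_at_origin a = a 0"

definition smult_series :: "'k::field_char_0 \<Rightarrow> 'k series \<Rightarrow> 'k series" where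
  "smult_series c a = (\<lambda>m. c * a m)"

definition coordinate :: "nat \<Rightarrow> 'k::field_char_0 series" where
  "coordinate i = (\<lambda>m. if m = Poly_Mapping.single i 1 then 1 else 0)"

text \<open>Sorting \<open>x\<^sup>p x\<^sup>q\<close> into an ordered monomial moves each factor \<open>x\<^sub>j\<close> of \<open>x\<^sup>q\<close> past the
  factors \<open>x\<^sub>i\<close> of \<open>x\<^sup>p\<close> with \<open>i > j\<close>.\<close>

definition product_sign :: "int list \<Rightarrow> monomial \<Rightarrow> monomial \<Rightarrow> 'k::field_char_0" where
  "product_sign ds p q =
     (-1) powi (\<Sum>i<length ds. \<Sum>j<i. coordinate_degree_in ds p i * coordinate_degree_in ds q j)"

definition mult_series ::
  "int list \<Rightarrow> 'k::field_char_0 series \<Rightarrow> 'k series \<Rightarrow> 'k series" where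
  "mult_series ds a b = (\<lambda>m. if m \<in> monomials ds
     then \<Sum>(p, q) | p + q = m. product_sign ds p q * a p * b q else 0)"

text \<open>The sum in the product is finite.\<close>

lemma finite_splittings: "finite {(p, q). p + q = (m :: monomial)}"
proof -
  let ?K = "Poly_Mapping.keys m"
  let ?L = "Poly_Mapping.lookup m"
  let ?F = "{f :: nat \<Rightarrow> nat. \<forall>i. (i \<in> ?K \<longrightarrow> f i \<in> {..Max (?L ` ?K)}) \<and> (i \<notin> ?K \<longrightarrow> f i = 0)}"
  have fin: "finite ?F"
    by (intro finite_set_of_finite_funs) auto
  have "Poly_Mapping.lookup p \<in> ?F" if m: "p + q = m" for p q
  proof -
    have le: "Poly_Mapping.lookup p i \<le> ?L i" for i
      unfolding m[symmetric] lookup_add by simp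
    show ?thesis
    proof (intro CollectI allI conjI impI)
      fix i assume "i \<in> ?K"
      then have "?L i \<le> Max (?L ` ?K)" by (intro Max_ge) simp_all
      then show "Poly_Mapping.lookup p i \<in> {..Max (?L ` ?K)}"
        using le[of i] by simp
    next
      fix i assume "i \<notin> ?K"
      then show "Poly_Mapping.lookup p i = 0"
        using le[of i] by (simp add: in_keys_iff)
    qed
  qed
  then have "\<And>pq. pq \<in> {(p, q). p + q = m} \<Longrightarrow> Poly_Mapping.lookup (fst pq) \<in> ?F"
    by (simp only: mem_Collect_eq case_prod_beta)
  then have "(\<lambda>pq. Poly_Mapping.lookup (fst pq)) ` {(p, q). p + q = m} \<subseteq> ?F"
    by (rule image_subsetI)
  moreover have "inj_on (\<lambda>pq. Poly_Mapping.lookup (fst pq)) {(p, q). p + q = m}"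
    unfolding inj_on_def lookup_inject by auto
  ultimately show ?thesis
    using fin inj_on_finite by blast
qed

text \<open>The left derivative \<open>\<partial>\<^sub>i\<close>, of degree \<open>- ds ! i\<close>: the sign comes from moving it past the
  coordinates \<open>x\<^sub>j\<close> with \<open>j < i\<close>.\<close>

definition partial :: "int list \<Rightarrow> nat \<Rightarrow> 'k::field_char_0 series \<Rightarrow> 'k series" where
  "partial ds i a = (\<lambda>m. (-1) powi (ds ! i * (\<Sum>j<i. coordinate_degree_in ds m j)) *
     of_nat (Poly_Mapping.lookup m i + 1) * a (m + Poly_Mapping.single i 1))"

section \<open>Vector fields and divergence\<close>

definition vector_field ::
  "int list \<Rightarrow> int \<Rightarrow> ('k::field_char_0 series \<Rightarrow> 'k series) \<Rightarrow> bool" where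
  "vector_field ds k X \<longleftrightarrow>
     (\<forall>d. \<forall>a\<in>graded_functions ds d. X a \<in> graded_functions ds (d + k)) \<and>
     (\<forall>d. \<forall>a\<in>graded_functions ds d. \<forall>b\<in>graded_functions ds d. X (a + b) = X a + X b) \<and>
     (\<forall>d. \<forall>a\<in>graded_functions ds d. \<forall>c. X (smult_series c a) = smult_series c (X a)) \<and>
     (\<forall>d e. \<forall>a\<in>graded_functions ds d. \<forall>b\<in>graded_functions ds e.
        X (mult_series ds a b) =
          mult_series ds (X a) b + smult_series ((-1) powi (k * d)) (mult_series ds a (X b)))"

text \<open>The component \<open>X\<^sup>i\<close> of \<open>X = \<Sum>\<^sub>i X\<^sup>i \<partial>\<^sub>i\<close> is \<open>X x\<^sub>i\<close>; for \<open>X\<close> of degree \<open>k\<close> it has degree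
  \<open>k + ds ! i\<close>.\<close>

definition divergence ::
  "int list \<Rightarrow> int \<Rightarrow> ('k::field_char_0 series \<Rightarrow> 'k series) \<Rightarrow> 'k series" where
  "divergence ds k X = (\<Sum>i<length ds.
     smult_series ((-1) powi (ds ! i * (k + ds ! i))) (partial ds i (X (coordinate i))))"

section \<open>\<open>L\<^sub>\<infinity>\<close>-algebras, unimodularity and the characteristic class\<close>

definition L_infinity ::
  "int list \<Rightarrow> ('k::field_char_0 series \<Rightarrow> 'k series) \<Rightarrow> bool" where
  "L_infinity ds Q \<longleftrightarrow>
     vector_field ds 1 Q \<and>
     (\<forall>d. \<forall>a\<in>graded_functions ds d. Q (Q a) = 0) \<and>
     (\<forall>d. \<forall>a\<in>graded_functions ds d. eval_at_origin (Q a) = 0)"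

definition unimodular_L_infinity ::
  "int list \<Rightarrow> ('k::field_char_0 series \<Rightarrow> 'k series) \<Rightarrow> 'k series \<Rightarrow> bool" where
  "unimodular_L_infinity ds Q f \<longleftrightarrow>
     L_infinity ds Q \<and> f \<in> graded_functions ds 0 \<and> eval_at_origin f = 0 \<and>
     divergence ds 1 Q + Q f = 0"

definition cocycles ::
  "int list \<Rightarrow> ('k::field_char_0 series \<Rightarrow> 'k series) \<Rightarrow> int \<Rightarrow> 'k series set" where
  "cocycles ds Q d = {a \<in> graded_functions ds d. Q a = 0}"

definition coboundaries ::
  "int list \<Rightarrow> ('k::field_char_0 series \<Rightarrow> 'k series) \<Rightarrow> int \<Rightarrow> 'k series set" where
  "coboundaries ds Q d = Q ` graded_functions ds (d - 1)"

definition cohomologous ::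
  "int list \<Rightarrow> ('k::field_char_0 series \<Rightarrow> 'k series) \<Rightarrow> int \<Rightarrow> 'k series rel" where
  "cohomologous ds Q d =
     {(a, b). a \<in> cocycles ds Q d \<and> b \<in> cocycles ds Q d \<and> a - b \<in> coboundaries ds Q d}"

definition cohomology ::
  "int list \<Rightarrow> ('k::field_char_0 series \<Rightarrow> 'k series) \<Rightarrow> int \<Rightarrow> 'k series set set" where
  "cohomology ds Q d = cocycles ds Q d // cohomologous ds Q d"

definition cohomology_class ::
  "int list \<Rightarrow> ('k::field_char_0 series \<Rightarrow> 'k series) \<Rightarrow> int \<Rightarrow> 'k series \<Rightarrow> 'k series set" where
  "cohomology_class ds Q d a = cohomologous ds Q d `` {a}"

lemma graded_functions_diff:
  "a \<in> graded_functions ds d \<Longrightarrow> b \<in> graded_functions ds d \<Longrightarrow> a - b \<in> graded_functions ds d"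
  unfolding graded_functions_def mem_Collect_eq fun_diff_def by (metis diff_self)

lemma vector_field_diff:
  assumes "vector_field ds k X" "a \<in> graded_functions ds d" "b \<in> graded_functions ds d"
  shows "X (a - b) = X a - X b"
proof -
  have "X (a - b + b) = X (a - b) + X b"
    using assms graded_functions_diff[OF assms(2,3)] unfolding vector_field_def by blast
  then show ?thesis by (simp add: eq_diff_eq)
qed

lemma equiv_cohomologous:
  assumes "L_infinity ds Q"
  shows "equiv (cocycles ds Q d) (cohomologous ds Q d)"
proof -
  have Q: "vector_field ds 1 Q" using assms by (simp add: L_infinity_def)
  have diff: "x - y \<in> coboundaries ds Q d"
    if "x \<in> coboundaries ds Q d" "y \<in> coboundaries ds Q d" for x y
  proof -
    obtain g h where gh: "g \<in> graded_functions ds (d - 1)" "h \<in> graded_functions ds (d - 1)"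
      and xy: "x = Q g" "y = Q h"
      using \<open>x \<in> _\<close> \<open>y \<in> _\<close> unfolding coboundaries_def by blast
    have "x - y = Q (g - h)" unfolding xy using vector_field_diff[OF Q gh] by simp
    then show ?thesis using graded_functions_diff[OF gh] unfolding coboundaries_def by blast
  qed
  have zero: "0 \<in> coboundaries ds Q d"
  proof -
    have z: "(0 :: 'a series) \<in> graded_functions ds (d - 1)" by (simp add: graded_functions_def)
    then have "Q 0 = 0" using vector_field_diff[OF Q z z] by simp
    then show ?thesis using z unfolding coboundaries_def by (simp add: image_iff) (metis)
  qed
  show ?thesis
  proof (rule equivI)
    show "cohomologous ds Q d \<subseteq> cocycles ds Q d \<times> cocycles ds Q d"
      by (auto simp: cohomologous_def)
    show "refl_on (cocycles ds Q d) (cohomologous ds Q d)"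
      using zero by (auto simp: refl_on_def cohomologous_def)
    show "sym (cohomologous ds Q d)"
    proof (rule symI)
      fix x y assume "(x, y) \<in> cohomologous ds Q d"
      then show "(y, x) \<in> cohomologous ds Q d"
        using diff[OF zero, of "x - y"] by (simp add: cohomologous_def)
    qed
    show "trans (cohomologous ds Q d)"
    proof (rule transI)
      fix x y z
      assume "(x, y) \<in> cohomologous ds Q d" "(y, z) \<in> cohomologous ds Q d"
      then have *: "x \<in> cocycles ds Q d" "z \<in> cocycles ds Q d"
        "x - y \<in> coboundaries ds Q d" "y - z \<in> coboundaries ds Q d"
        by (auto simp: cohomologous_def)
      have "(x - y) - (0 - (y - z)) \<in> coboundaries ds Q d"
        using diff *(3,4) zero by blast
      then show "(x, z) \<in> cohomologous ds Q d" using *(1,2) by (simp add: cohomologous_def)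
    qed
  qed
qed

lemma cohomology_class_in_cohomology:
  "a \<in> cocycles ds Q d \<Longrightarrow> cohomology_class ds Q d a \<in> cohomology ds Q d"
  unfolding cohomology_class_def cohomology_def by (rule quotientI)

definition characteristic_class ::
  "int list \<Rightarrow> ('k::field_char_0 series \<Rightarrow> 'k series) \<Rightarrow> 'k series set" where
  "characteristic_class ds Q = cohomology_class ds Q 1 (divergence ds 1 Q)"

end

theory Submission
  imports Defs
begin

text \<open>Write \<open>D\<close> for the divergence of \<open>Q\<close>. Up to the sign of the function, the equation
  \<open>D + Q f = 0\<close> says that \<open>D\<close> is exact, so the two sides of the equivalence differ in two respects.

  First, a primitive \<open>g\<close> of \<open>D\<close> need not vanish at the origin, whereas \<open>f\<close> has to. Its value there
  can be removed, because every derivation kills the constants (\<open>vector_field_constant\<close>): the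
  function \<open>f = g(0) - g\<close> vanishes at the origin and satisfies \<open>Q f = - D\<close>.

  Second, cohomology classes only make sense for cocycles. In one direction closedness comes with
  exactness, since \<open>Q Q = 0\<close>. In the other direction the class of \<open>0\<close> contains \<open>0\<close>, so
  if the class of \<open>D\<close> is the same set, then \<open>D\<close> is related to \<open>0\<close>, and this relation includes
  closedness. The argument is the same for any function in place of \<open>D\<close>
  (\<open>cohomology_class_eq_zero_iff\<close>).\<close>

definition one_series :: "'k::field_char_0 series" where
  "one_series = (\<lambda>m. if m = 0 then 1 else 0)"

lemma one_series_graded: "one_series \<in> graded_functions ds 0"
  by (auto simp: one_series_def graded_functions_def monomials_def monomial_degree_def
      coordinate_degree_in_def)

lemma zero_graded: "(0 :: 'k::field_char_0 series) \<in> graded_functions ds d"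
  by (simp add: graded_functions_def)

lemma smult_series_graded:
  "a \<in> graded_functions ds d \<Longrightarrow> smult_series c a \<in> graded_functions ds d"
  by (auto simp: graded_functions_def smult_series_def)

lemma product_sign_zero [simp]: "product_sign ds p 0 = 1" "product_sign ds 0 q = 1"
  by (simp_all add: product_sign_def coordinate_degree_in_def)

lemma mult_series_one_right:
  fixes a :: "'k::field_char_0 series"
  assumes "a \<in> graded_functions ds d"
  shows "mult_series ds a one_series = a"
proof
  fix m
  let ?t = "\<lambda>(p, q). product_sign ds p q * a p * one_series q :: 'k"
  have "sum ?t {(p, q). p + q = m} = sum ?t {(m, 0)}"
    by (rule sum.mono_neutral_right[OF finite_splittings]) (auto simp: one_series_def split: if_splits)
  then show "mult_series ds a one_series m = a m"
    using assms by (auto simp: mult_series_def graded_functions_def one_series_def)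
qed

lemma mult_series_one_left:
  fixes a :: "'k::field_char_0 series"
  assumes "a \<in> graded_functions ds d"
  shows "mult_series ds one_series a = a"
proof
  fix m
  let ?t = "\<lambda>(p, q). product_sign ds p q * one_series p * a q :: 'k"
  have "sum ?t {(p, q). p + q = m} = sum ?t {(0, m)}"
    by (rule sum.mono_neutral_right[OF finite_splittings]) (auto simp: one_series_def split: if_splits)
  then show "mult_series ds one_series a m = a m"
    using assms by (auto simp: mult_series_def graded_functions_def one_series_def)
qed

text \<open>The Leibniz rule for \<open>1 \<cdot> 1 = 1\<close> reads \<open>X 1 = X 1 + X 1\<close>, without a sign because \<open>1\<close>
  has degree \<open>0\<close>.\<close>

lemma vector_field_one:
  fixes X :: "'k::field_char_0 series \<Rightarrow> 'k series"
  assumes "vector_field ds k X"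
  shows "X one_series = 0"
proof -
  have deg: "X one_series \<in> graded_functions ds (0 + k)"
    using assms one_series_graded unfolding vector_field_def by blast
  have "X (mult_series ds one_series one_series) =
      mult_series ds (X one_series) one_series +
      smult_series ((-1) powi (k * 0)) (mult_series ds one_series (X one_series))"
    using assms one_series_graded unfolding vector_field_def by blast
  then have "X one_series = X one_series + X one_series"
    by (simp add: mult_series_one_right[OF one_series_graded] mult_series_one_right[OF deg]
        mult_series_one_left[OF deg] smult_series_def)
  then show ?thesis by simp
qed

lemma vector_field_constant:
  assumes "vector_field ds k X"
  shows "X (smult_series c one_series) = 0"
proof -
  have "X (smult_series c one_series) = smult_series c (X one_series)"
    using assms one_series_graded unfolding vector_field_def by blast
  then show ?thesis by (simp add: vector_field_one[OF assms] smult_series_def fun_eq_iff)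
qed

text \<open>As classes are formed by the relation on cocycles, the class of a function that is not closed
  is the empty set. It differs from the class of \<open>0\<close>, so the equivalence holds for every function
  \<open>a\<close>.\<close>

lemma cohomology_class_eq_zero_iff:
  assumes "L_infinity ds Q"
  shows "cohomology_class ds Q d a = cohomology_class ds Q d 0 \<longleftrightarrow> a \<in> coboundaries ds Q d"
proof
  have Q: "vector_field ds 1 Q" using assms by (simp add: L_infinity_def)
  have "Q 0 = 0" using vector_field_diff[OF Q zero_graded zero_graded] by simp
  then have zero: "0 \<in> cocycles ds Q d" by (simp add: cocycles_def zero_graded)
  note equiv = equiv_cohomologous[OF assms, of d]
  {
    assume "cohomology_class ds Q d a = cohomology_class ds Q d 0"
    then have "0 \<in> cohomology_class ds Q d a"
      using equiv_class_self[OF equiv zero] by (simp add: cohomology_class_def)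
    then show "a \<in> coboundaries ds Q d"
      by (simp add: cohomology_class_def cohomologous_def)
  next
    assume a: "a \<in> coboundaries ds Q d"
    then obtain g where g: "g \<in> graded_functions ds (d - 1)" and a_eq: "a = Q g"
      unfolding coboundaries_def by blast
    have "Q g \<in> graded_functions ds (d - 1 + 1)"
      using Q g unfolding vector_field_def by blast
    moreover have "Q (Q g) = 0" using assms g unfolding L_infinity_def by blast
    ultimately have "(a, 0) \<in> cohomologous ds Q d"
      using a zero by (simp add: cohomologous_def cocycles_def a_eq)
    then show "cohomology_class ds Q d a = cohomology_class ds Q d 0"
      unfolding cohomology_class_def by (rule equiv_class_eq[OF equiv])
  }
qed

lemma unimodular_extension_iff:
  assumes "L_infinity ds Q"
  shows "(\<exists>f. unimodular_L_infinity ds Q f) \<longleftrightarrow> divergence ds 1 Q \<in> coboundaries ds Q 1"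
proof
  have Q: "vector_field ds 1 Q" using assms by (simp add: L_infinity_def)
  {
    assume "\<exists>f. unimodular_L_infinity ds Q f"
    then obtain f where f: "f \<in> graded_functions ds 0" "divergence ds 1 Q + Q f = 0"
      unfolding unimodular_L_infinity_def by blast
    have "Q 0 = 0" using vector_field_diff[OF Q zero_graded zero_graded] by simp
    then have "Q (0 - f) = - Q f" using vector_field_diff[OF Q zero_graded f(1)] by simp
    moreover have "divergence ds 1 Q = - Q f" using f(2) by (rule eq_neg_iff_add_eq_0[THEN iffD2])
    ultimately have "divergence ds 1 Q = Q (0 - f)" by metis
    then show "divergence ds 1 Q \<in> coboundaries ds Q 1"
      using graded_functions_diff[OF zero_graded f(1)] unfolding coboundaries_def by simp
  next
    assume "divergence ds 1 Q \<in> coboundaries ds Q 1"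
    then obtain g where g: "g \<in> graded_functions ds 0" "divergence ds 1 Q = Q g"
      unfolding coboundaries_def by auto
    define c where "c = smult_series (eval_at_origin g) one_series"
    have c: "c \<in> graded_functions ds 0"
      unfolding c_def by (intro smult_series_graded one_series_graded)
    have "Q (c - g) = - divergence ds 1 Q"
      using vector_field_diff[OF Q c g(1)] vector_field_constant[OF Q] g(2) by (simp add: c_def)
    moreover have "eval_at_origin (c - g) = 0"
      by (simp add: c_def eval_at_origin_def smult_series_def one_series_def)
    ultimately have "unimodular_L_infinity ds Q (c - g)"
      using assms graded_functions_diff[OF c g(1)] by (simp add: unimodular_L_infinity_def)
    then show "\<exists>f. unimodular_L_infinity ds Q f" by blast
  }
qed

theorem proposition2:
  fixes scale :: "'k::field_char_0 \<Rightarrow> 'v::ab_group_add \<Rightarrow> 'v"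
    and V :: "int \<Rightarrow> 'v set"
    and es :: "'v list"
    and Q :: "'k series \<Rightarrow> 'k series"
  assumes "graded_vector_space scale V"
    and "graded_vector_space.homogeneous_basis scale V es"
    and "L_infinity (coordinate_degrees V es) Q"
  shows "(\<exists>f. unimodular_L_infinity (coordinate_degrees V es) Q f) \<longleftrightarrow>
    characteristic_class (coordinate_degrees V es) Q =
      cohomology_class (coordinate_degrees V es) Q 1 0"
  unfolding characteristic_class_def unimodular_extension_iff[OF assms(3)]
    cohomology_class_eq_zero_iff[OF assms(3)] ..

end
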